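(* Let $D$ be a weighted naturally oriented even cycle with underlying graph $C_n=(x_1,\ldots,x_n)$, where $n\ne4$, and suppose at least one vertex of $D$ has non-trivial weight. Then $I(D)^{(s)}=I(D)^s$ for all $s\ge2$ if and only if all vertices of $D$ have non-trivial weights.
   Context: Let $k$ be a field. A weighted oriented graph $D=(V(D),E(D),w)$ has a finite vertex set $V(D)$, a set $E(D)$ of ordered pairs of distinct vertices ($(x,y)\in E(D)$ is a directed edge from $x$ to $y$), each edge $\{x,y\}$ of the underlying simple graph $G$ carrying exactly one orientation, and a weight function $w:V(D)\to\mathbb N=\{1,2,\dots\}$. A vertex is a source if it has only outgoing edges; convention: sources have weight $1$. A weight is non-trivial if it is $\ne1$. The edge ideal of $D$ is $I(D)=(x\,y^{w(y)} : (x,y)\in E(D))$ in the polynomial ring $R$ over $k$ whose variables are the vertices of $D$. For $s\ge1$ the $s$-th symbolic power of an ideal $I$ is $I^{(s)}=\bigcap_{P\in\operatorname{Ass}(I)}(I^sR_P\cap R)$, where $\operatorname{Ass}(I)$ is the set of associated primes of $R/I$. A cycle is naturally oriented if all its edges are oriented in the clockwise direction (i.e. it is a directed cycle). *)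

theory Defs
  imports
    "HOL-Library.Poly_Mapping"
    "HOL-Computational_Algebra.Polynomial_Factorial"
    "HOL-Algebra.Ideal_Product"
    "HOL-Algebra.Algebraic_Closure_Type"
begin

section \<open>Weighted oriented graphs\<close>

record 'v wograph =
  verts :: "'v set"
  edges :: "('v \<times> 'v) set"
  weight :: "'v \<Rightarrow> nat"

definition source :: "'v wograph \<Rightarrow> 'v \<Rightarrow> bool" where
  "source D v \<longleftrightarrow> v \<in> verts D \<and> (\<forall>u. (u, v) \<notin> edges D)"

locale weighted_oriented_graph =
  fixes D :: "'v wograph"
  assumes finite_verts: "finite (verts D)"
    and edges_subset: "edges D \<subseteq> verts D \<times> verts D"
    and no_loops: "(x, x) \<notin> edges D"
    and one_orientation: "(x, y) \<in> edges D \<Longrightarrow> (y, x) \<notin> edges D"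
    and weight_pos: "x \<in> verts D \<Longrightarrow> 1 \<le> weight D x"
    and source_weight: "source D x \<Longrightarrow> weight D x = 1"

definition naturally_oriented_cycle :: "'v wograph \<Rightarrow> 'v list \<Rightarrow> bool" where
  "naturally_oriented_cycle D xs \<longleftrightarrow>
     3 \<le> length xs \<and> distinct xs \<and> verts D = set xs \<and>
     edges D = {(xs ! i, xs ! (Suc i mod length xs)) | i. i < length xs}"


section \<open>Polynomial rings and edge ideals\<close>

text \<open>Polynomials are finitely supported maps from exponent vectors to coefficients;
  the carrier consists of those involving only variables from \<open>V\<close>.\<close>

definition mpoly_ring :: "'v set \<Rightarrow> (('v \<Rightarrow>\<^sub>0 nat) \<Rightarrow>\<^sub>0 'k::field) ring" where
  "mpoly_ring V = ring_of_type_algebra \<lparr>carrier := {p. \<forall>m \<in> Poly_Mapping.keys p. Poly_Mapping.keys m \<subseteq> V}\<rparr>"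

definition Var :: "'v \<Rightarrow> ('v \<Rightarrow>\<^sub>0 nat) \<Rightarrow>\<^sub>0 'k::field" where
  "Var v = Poly_Mapping.single (Poly_Mapping.single v 1) 1"

definition edge_ideal :: "'v wograph \<Rightarrow> (('v \<Rightarrow>\<^sub>0 nat) \<Rightarrow>\<^sub>0 'k::field) set" where
  "edge_ideal D = genideal (mpoly_ring (verts D)) {Var x * Var y ^ weight D y | x y. (x, y) \<in> edges D}"


section \<open>Symbolic powers\<close>

definition ideal_power :: "'a ring \<Rightarrow> 'a set \<Rightarrow> nat \<Rightarrow> 'a set" where
  "ideal_power R I s = I [^]\<^bsub>ideals_set R\<^esub> s"

text \<open>The primes that are annihilators of an element \<open>f + I\<close> of \<open>R/I\<close>.\<close>

definition assoc_primes :: "'a ring \<Rightarrow> 'a set \<Rightarrow> 'a set set" where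
  "assoc_primes R I =
     {P. primeideal P R \<and> (\<exists>f \<in> carrier R. P = {r \<in> carrier R. r \<otimes>\<^bsub>R\<^esub> f \<in> I})}"

text \<open>Here \<open>R\<close> is a subring of an integral domain given by a type, so that \<open>R\<^sub>P\<close> can be
  realised inside the field of fractions of that type.\<close>

definition localization :: "'a::idom ring \<Rightarrow> 'a set \<Rightarrow> 'a fract ring" where
  "localization R P =
     ring_of_type_algebra \<lparr>carrier := {Fract a u | a u. a \<in> carrier R \<and> u \<in> carrier R - P}\<rparr>"

definition symbolic_power :: "'a::idom ring \<Rightarrow> 'a set \<Rightarrow> nat \<Rightarrow> 'a set" where
  "symbolic_power R I s =
     {f \<in> carrier R. \<forall>P \<in> assoc_primes R I.
        to_fract f \<in> genideal (localization R P) (to_fract ` ideal_power R I s)}"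

end

theory Submission
  imports Defs
begin

text \<open>Write \<open>e(u,v) = u v\<^bsup>w(v)\<^esup>\<close> for the generator of an edge. If all weights are at least 2,
  then \<open>I : g\<close> with \<open>g = \<Prod>v. v\<^bsup>w(v)-1\<^esup>\<close> is the maximal ideal \<open>\<mm>\<close> of the origin. So \<open>\<mm>\<close> is
  associated, and since \<open>I\<^sup>s\<close> is a monomial ideal, localising at \<open>\<mm>\<close> and contracting gives back
  \<open>I\<^sup>s\<close>.

  Otherwise the cycle contains a path \<open>p, a, b, c, d\<close> with \<open>w(a) \<ge> 2\<close> and \<open>w(b) = 1\<close>, and
  \<open>f = p a\<^bsup>w(a)\<^esup> b\<^sup>2 c\<^bsup>w(c)\<^esup>\<close> separates the symbolic cube from the cube: because \<open>w(b) = 1\<close>, no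
  associated prime contains all of \<open>b, c, d\<close>, while \<open>b f\<close>, \<open>c\<^bsup>w(c)\<^esup> f\<close> and \<open>d\<^bsup>w(d)\<^esup> f\<close> are multiples
  of \<open>e(a,b)\<^sup>2 e(b,c)\<close>, \<open>e(p,a) e(b,c)\<^sup>2\<close> and \<open>e(a,b)\<^sup>2 e(c,d)\<close> respectively.\<close>

section \<open>Rings carried by subsets of a type, and their localizations\<close>

abbreviation type_subring :: "'a::comm_ring_1 set \<Rightarrow> 'a ring" where
  "type_subring S \<equiv> ring_of_type_algebra\<lparr>carrier := S\<rparr>"

lemma ring_of_type_algebra_simps [simp]:
  "carrier ring_of_type_algebra = UNIV"
  "x \<otimes>\<^bsub>ring_of_type_algebra\<^esub> y = x * y"
  "x \<oplus>\<^bsub>ring_of_type_algebra\<^esub> y = x + y"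
  "\<one>\<^bsub>ring_of_type_algebra\<^esub> = 1"
  "\<zero>\<^bsub>ring_of_type_algebra\<^esub> = 0"
  by (simp_all add: ring_of_type_algebra_def)

lemma cring_type_subring:
  fixes S :: "'a::comm_ring_1 set"
  assumes "1 \<in> S"
    and add: "\<And>x y. x \<in> S \<Longrightarrow> y \<in> S \<Longrightarrow> x + y \<in> S"
    and uminus: "\<And>x. x \<in> S \<Longrightarrow> - x \<in> S"
    and "\<And>x y. x \<in> S \<Longrightarrow> y \<in> S \<Longrightarrow> x * y \<in> S"
  shows "cring (type_subring S)"
proof (rule cringI)
  have "0 \<in> S"
    using add[OF \<open>1 \<in> S\<close> uminus[OF \<open>1 \<in> S\<close>]] by simp
  then show "abelian_group (type_subring S)"
    by (intro abelian_groupI) (auto simp: algebra_simps assms intro!: bexI[OF _ uminus])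
  show "Group.comm_monoid (type_subring S)"
    by (rule Group.comm_monoidI) (auto simp: algebra_simps assms)
qed (auto simp: algebra_simps)

lemma ideal_type_subringI:
  fixes S :: "'a::comm_ring_1 set"
  assumes "ring (type_subring S)" "I \<subseteq> S" "0 \<in> I"
    and "\<And>x y. x \<in> I \<Longrightarrow> y \<in> I \<Longrightarrow> x + y \<in> I"
    and mult: "\<And>x y. x \<in> S \<Longrightarrow> y \<in> I \<Longrightarrow> x * y \<in> I"
  shows "ideal I (type_subring S)"
proof (rule idealI)
  interpret ring "type_subring S" by fact
  have neg: "\<ominus>\<^bsub>type_subring S\<^esub> x = - x" if "x \<in> S" for x
    using l_neg[of x] that by (simp add: eq_neg_iff_add_eq_0)
  \<comment> \<open>Closure of \<open>I\<close> under negation is absorption of the factor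
    \<open>- 1\<close>.\<close>
  have "- 1 \<in> S"
    using a_inv_closed[of 1] one_closed by (simp add: neg)
  then have "- x \<in> I" if "x \<in> I" for x
    using mult[of "- 1" x] that by simp
  then have "inv\<^bsub>add_monoid (type_subring S)\<^esub> x \<in> I" if "x \<in> I" for x
    using neg[of x] that assms(2) by (auto simp: a_inv_def)
  then show "subgroup I (add_monoid (type_subring S))"
    using assms by (auto simp: subgroup_def)
  show "a \<otimes>\<^bsub>type_subring S\<^esub> x \<in> I" if "a \<in> I" "x \<in> carrier (type_subring S)" for a x
    using mult[of x a] that by (simp add: mult.commute)
qed (use assms in auto)

text \<open>Fractions with numerator in \<open>J\<close> and denominator outside \<open>P\<close>
  already form an ideal of the localization, because primality makes the denominators closed under
  products. So the extension of \<open>J\<close> contains nothing else, and clearing denominators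
  removes fractions from the definition of a symbolic power.\<close>

lemma to_fract_mem_localized_ideal_iff:
  fixes S :: "'a::idom set"
  assumes P: "primeideal P (type_subring S)" and J: "ideal J (type_subring S)" and "f \<in> S"
  shows "to_fract f \<in> genideal (localization (type_subring S) P) (to_fract ` J)
    \<longleftrightarrow> (\<exists>u \<in> S - P. u * f \<in> J)"
proof -
  interpret P: primeideal P "type_subring S" by fact
  interpret J: ideal J "type_subring S" by fact
  define L where "L = {Fract a u | a u. a \<in> S \<and> u \<in> S - P}"
  define K where "K = {Fract a u | a u. a \<in> J \<and> u \<in> S - P}"
  have loc: "localization (type_subring S) P = type_subring L"
    by (simp add: localization_def L_def)
  have one: "1 \<in> S - P"
    using P.one_closed P.one_imp_carrier P.I_notcarr by auto
  have nz: "u \<noteq> 0" if "u \<in> S - P" for u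
    using that additive_subgroup.zero_closed[OF P.additive_subgroup_axioms] by auto
  have mult: "u * v \<in> S - P" if "u \<in> S - P" "v \<in> S - P" for u v
    using that P.I_prime[of u v] P.m_closed[of u v] by auto
  have neg: "- x \<in> S" if "x \<in> S" for x
  proof -
    have "\<ominus>\<^bsub>type_subring S\<^esub> x = - x"
      using P.l_neg[of x] that by (simp add: eq_neg_iff_add_eq_0)
    then show ?thesis
      using P.a_inv_closed[of x] that by simp
  qed
  have "cring (type_subring L)"
  proof (rule cring_type_subring)
    show "1 \<in> L"
      using one by (force simp: L_def One_fract_def)
    fix x assume "x \<in> L"
    then obtain a u where x: "x = Fract a u" "a \<in> S" "u \<in> S - P"
      by (auto simp: L_def)
    then show "- x \<in> L"
      using neg nz by (force simp: L_def)
    fix y assume "y \<in> L"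
    then obtain b v where y: "y = Fract b v" "b \<in> S" "v \<in> S - P"
      by (auto simp: L_def)
    have "a * v + b * u \<in> S" "a * b \<in> S"
      using x y P.m_closed[of a v] P.m_closed[of b u] P.m_closed[of a b]
        P.a_closed[of "a * v" "b * u"] by auto
    then show "x + y \<in> L" "x * y \<in> L"
      using x y mult[of u v] nz by (auto simp: L_def; blast)+
  qed
  then have ring: "ring (type_subring L)"
    by (rule cring.axioms)
  have "ideal K (type_subring L)"
  proof (rule ideal_type_subringI[OF ring])
    show "K \<subseteq> L"
      using J.a_subset by (force simp: K_def L_def)
    show "0 \<in> K"
      using one J.zero_closed by (force simp: K_def Zero_fract_def)
  next
    fix x y assume "x \<in> K" "y \<in> K"
    then obtain a u b v where x: "x = Fract a u" "a \<in> J" "u \<in> S - P"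
      and y: "y = Fract b v" "b \<in> J" "v \<in> S - P"
      by (auto simp: K_def)
    have "a * v + b * u \<in> J"
      using x y J.I_r_closed[of a v] J.I_r_closed[of b u] J.a_closed[of "a * v" "b * u"] by auto
    then show "x + y \<in> K"
      using x y mult[of u v] nz by (auto simp: K_def; blast)
  next
    fix x y assume "x \<in> L" "y \<in> K"
    then obtain a u b v where x: "x = Fract a u" "a \<in> S" "u \<in> S - P"
      and y: "y = Fract b v" "b \<in> J" "v \<in> S - P"
      by (auto simp: K_def L_def)
    have "a * b \<in> J"
      using x y J.I_l_closed[of b a] by auto
    then show "x * y \<in> K"
      using x y mult[of u v] by (auto simp: K_def; blast)
  qed
  moreover have "to_fract ` J \<subseteq> K"
    using one by (force simp: K_def to_fract_def)
  ultimately have sub: "genideal (type_subring L) (to_fract ` J) \<subseteq> K"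
    by (rule ring.genideal_minimal[OF ring])
  show ?thesis
    unfolding loc
  proof
    assume "to_fract f \<in> genideal (type_subring L) (to_fract ` J)"
    then obtain a u where "to_fract f = Fract a u" "a \<in> J" "u \<in> S - P"
      using sub by (auto simp: K_def)
    then show "\<exists>u \<in> S - P. u * f \<in> J"
      using nz[of u] by (auto simp: to_fract_def eq_fract mult.commute intro!: bexI[of _ u])
  next
    assume "\<exists>u \<in> S - P. u * f \<in> J"
    then obtain u where u: "u \<in> S - P" "u * f \<in> J" by auto
    have inv: "Fract 1 u \<in> L" and eq: "to_fract f = Fract 1 u * to_fract (u * f)"
      using u one nz[of u] by (force simp: L_def, simp add: to_fract_def eq_fract mult.commute)
    show "to_fract f \<in> genideal (type_subring L) (to_fract ` J)"
      unfolding genideal_def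
    proof safe
      fix I assume "ideal I (type_subring L)" "to_fract ` J \<subseteq> I"
      then show "to_fract f \<in> I"
        using ideal.I_l_closed[of I "type_subring L" "to_fract (u * f)" "Fract 1 u"] u(2) inv
        unfolding eq by auto
    qed
  qed
qed

subsection \<open>Monomial ideals\<close>

definition monomials :: "'v set \<Rightarrow> ('v \<Rightarrow>\<^sub>0 nat) set" where
  "monomials V = {m. Poly_Mapping.keys m \<subseteq> V}"

text \<open>One encoding serves the polynomial ring (\<open>A = monomials V\<close>) and its
  monomial ideals: membership is tested on each exponent vector separately.\<close>

definition poly_on :: "'m set \<Rightarrow> ('m \<Rightarrow>\<^sub>0 'k::zero) set" where
  "poly_on A = {p. Poly_Mapping.keys p \<subseteq> A}"

text \<open>Monomial ideals seen through their exponent sets: multiplying monomials is adding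
  exponents.\<close>

definition monomial_ideal :: "'v set \<Rightarrow> ('v \<Rightarrow>\<^sub>0 nat) set \<Rightarrow> bool" where
  "monomial_ideal V A \<longleftrightarrow> A \<subseteq> monomials V \<and> (\<forall>a \<in> A. \<forall>b \<in> monomials V. a + b \<in> A)"

text \<open>The exponents of the \<open>s\<close>-th power of the ideal generated by the monomials
  with exponents in \<open>G\<close>. The arbitrary cofactor enters once, at stage 0; each later
  stage adds a bare generator.\<close>

fun power_monomials :: "'v set \<Rightarrow> ('v \<Rightarrow>\<^sub>0 nat) set \<Rightarrow> nat \<Rightarrow> ('v \<Rightarrow>\<^sub>0 nat) set" where
  "power_monomials V G 0 = monomials V"
| "power_monomials V G (Suc s) = {a + e | a e. a \<in> power_monomials V G s \<and> e \<in> G}"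

text \<open>Exponents are natural numbers, so nothing cancels.\<close>

lemma keys_add_nat:
  fixes a b :: "'v \<Rightarrow>\<^sub>0 nat"
  shows "Poly_Mapping.keys (a + b) = Poly_Mapping.keys a \<union> Poly_Mapping.keys b"
  by (auto simp: in_keys_iff lookup_add)

lemma monomials_add_iff [simp]: "a + b \<in> monomials V \<longleftrightarrow> a \<in> monomials V \<and> b \<in> monomials V"
  by (auto simp: monomials_def keys_add_nat)

lemma zero_in_monomials [simp]: "0 \<in> monomials V"
  by (simp add: monomials_def)

lemma single_in_monomials [simp]: "v \<in> V \<Longrightarrow> Poly_Mapping.single v k \<in> monomials V"
  by (simp add: monomials_def)

lemma single_in_poly_on_iff [simp]: "c \<noteq> 0 \<Longrightarrow> Poly_Mapping.single m c \<in> poly_on A \<longleftrightarrow> m \<in> A"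
  by (simp add: poly_on_def)

lemma poly_on_closed:
  shows "0 \<in> poly_on A"
    and "p \<in> poly_on A \<Longrightarrow> q \<in> poly_on A \<Longrightarrow> p + q \<in> poly_on A"
    and "r \<in> poly_on A \<Longrightarrow> - r \<in> poly_on A"
  using keys_add[of p q] by (auto simp: poly_on_def in_keys_iff)

lemma mult_in_poly_on:
  assumes "p \<in> poly_on A" "q \<in> poly_on B" "\<And>a b. a \<in> A \<Longrightarrow> b \<in> B \<Longrightarrow> a + b \<in> C"
  shows "p * q \<in> poly_on C"
  using assms keys_mult[of p q] unfolding poly_on_def by blast

lemma poly_mapping_sum_single:
  "p = (\<Sum>k\<in>Poly_Mapping.keys p. Poly_Mapping.single k (Poly_Mapping.lookup p k))"
  by (rule poly_mapping_eqI) (auto simp: lookup_sum lookup_single when_def in_keys_iff sum.delta)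

text \<open>A polynomial is the finite sum of its terms, so inclusions of monomial ideals can be
  tested on single terms.\<close>

lemma poly_on_subsetI:
  fixes T :: "('m \<Rightarrow>\<^sub>0 'k::comm_monoid_add) set"
  assumes "0 \<in> T" "\<And>p q. p \<in> T \<Longrightarrow> q \<in> T \<Longrightarrow> p + q \<in> T"
    and "\<And>a c. a \<in> A \<Longrightarrow> Poly_Mapping.single a c \<in> T"
  shows "poly_on A \<subseteq> T"
proof
  fix p :: "'m \<Rightarrow>\<^sub>0 'k" assume p: "p \<in> poly_on A"
  have "(\<Sum>k\<in>K. Poly_Mapping.single k (Poly_Mapping.lookup p k)) \<in> T"
    if "finite K" "K \<subseteq> A" for K
    using that by (induction K rule: finite_induct) (auto simp: assms)
  then show "p \<in> T"
    using p poly_mapping_sum_single[of p] by (metis finite_keys mem_Collect_eq poly_on_def)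
qed

lemma lookup_single_mult:
  fixes p :: "('v \<Rightarrow>\<^sub>0 nat) \<Rightarrow>\<^sub>0 'k::field"
  shows "Poly_Mapping.lookup (Poly_Mapping.single m c * p) (m + k) = c * Poly_Mapping.lookup p k"
proof -
  have "Poly_Mapping.single m c * p =
      (\<Sum>l\<in>Poly_Mapping.keys p. Poly_Mapping.single (m + l) (c * Poly_Mapping.lookup p l))"
    by (subst (1) poly_mapping_sum_single[of p]) (simp add: sum_distrib_left mult_single)
  then show ?thesis
    by (simp add: lookup_sum lookup_single when_def in_keys_iff sum.delta)
qed

text \<open>Split \<open>u\<close> into its constant term \<open>c\<close> and the rest; by
  hypothesis no product of a monomial of the rest with one of \<open>p\<close> lands on
  \<open>m\<close>.\<close>

lemma lookup_mult_constant_part: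
  fixes p u :: "('v \<Rightarrow>\<^sub>0 nat) \<Rightarrow>\<^sub>0 'k::field"
  assumes "\<And>a b. a \<in> Poly_Mapping.keys u \<Longrightarrow> b \<in> Poly_Mapping.keys p \<Longrightarrow> a \<noteq> 0 \<Longrightarrow> m \<noteq> a + b"
  shows "Poly_Mapping.lookup (u * p) m = Poly_Mapping.lookup u 0 * Poly_Mapping.lookup p m"
proof -
  define c where "c = Poly_Mapping.single (0 :: 'v \<Rightarrow>\<^sub>0 nat) (Poly_Mapping.lookup u 0)"
  have "a \<in> Poly_Mapping.keys u \<and> a \<noteq> 0" if "a \<in> Poly_Mapping.keys (u - c)" for a
    using that by (auto simp: in_keys_iff lookup_minus c_def lookup_single when_def split: if_splits)
  then have "m \<notin> Poly_Mapping.keys ((u - c) * p)"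
    using assms keys_mult[of "u - c" p] by blast
  moreover have "u * p = c * p + (u - c) * p"
    by (simp add: algebra_simps)
  ultimately show ?thesis
    using lookup_single_mult[of 0 _ p m] by (simp add: lookup_add in_keys_iff c_def)
qed

text \<open>Evaluation at the origin is multiplicative, which later makes the ideal of the origin
  prime.\<close>

lemma lookup_mult_zero:
  fixes p q :: "('v \<Rightarrow>\<^sub>0 nat) \<Rightarrow>\<^sub>0 'k::field"
  shows "Poly_Mapping.lookup (p * q) 0 = Poly_Mapping.lookup p 0 * Poly_Mapping.lookup q 0"
proof (rule lookup_mult_constant_part)
  fix a b :: "'v \<Rightarrow>\<^sub>0 nat"
  assume "a \<noteq> 0"
  then show "0 \<noteq> a + b"
    by (metis keys_add_nat keys_eq_empty keys_zero sup_eq_bot_iff)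
qed

lemma mpoly_ring_eq: "mpoly_ring V = type_subring (poly_on (monomials V))"
  by (simp add: mpoly_ring_def poly_on_def monomials_def subset_iff Ball_def)

lemma cring_mpoly_ring: "cring (type_subring (poly_on (monomials V) :: (_ \<Rightarrow>\<^sub>0 'k::field) set))"
  by (rule cring_type_subring)
    (auto intro: poly_on_closed mult_in_poly_on simp flip: single_one)

lemma ideal_poly_on:
  assumes "monomial_ideal V A"
  shows "ideal (poly_on A :: (_ \<Rightarrow>\<^sub>0 'k::field) set) (type_subring (poly_on (monomials V)))"
proof (rule ideal_type_subringI[OF cring.axioms(1)[OF cring_mpoly_ring]])
  show "x * y \<in> poly_on A" if "x \<in> poly_on (monomials V)" "y \<in> poly_on A" for x y :: "_ \<Rightarrow>\<^sub>0 'k"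
  proof (rule mult_in_poly_on[OF that])
    show "a + b \<in> A" if "a \<in> monomials V" "b \<in> A" for a b
      using assms that by (metis monomial_ideal_def add.commute)
  qed
qed (use assms in \<open>auto simp: monomial_ideal_def poly_on_def dest!: subsetD[OF keys_add]\<close>)

text \<open>Compare coefficients at a monomial of \<open>p\<close> outside \<open>A\<close> of least degree.\<close>

lemma poly_on_cancel_unit:
  fixes p u :: "('v \<Rightarrow>\<^sub>0 nat) \<Rightarrow>\<^sub>0 'k::field"
  assumes "finite V" and A: "monomial_ideal V A"
    and p: "p \<in> poly_on (monomials V)" and u: "u \<in> poly_on (monomials V)"
    and u0: "Poly_Mapping.lookup u 0 \<noteq> 0" and up: "u * p \<in> poly_on A"
  shows "p \<in> poly_on A"
proof (rule ccontr)
  define deg :: "('v \<Rightarrow>\<^sub>0 nat) \<Rightarrow> nat" where "deg m = (\<Sum>v\<in>V. Poly_Mapping.lookup m v)" for m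
  assume "p \<notin> poly_on A"
  then obtain m0 where "m0 \<in> Poly_Mapping.keys p - A"
    by (auto simp: poly_on_def)
  then obtain m where m: "m \<in> Poly_Mapping.keys p - A"
    and least: "\<And>l. l \<in> Poly_Mapping.keys p - A \<Longrightarrow> deg m \<le> deg l"
    using ex_has_least_nat[of "\<lambda>m. m \<in> Poly_Mapping.keys p - A" m0 deg]
    by blast
  \<comment> \<open>Any other contribution to the coefficient at \<open>m\<close> comes from
    \<open>m = a + b\<close> with \<open>a \<noteq> 0\<close>; then \<open>b\<close> has smaller
    degree and is outside \<open>A\<close>, since \<open>A\<close> absorbs \<open>a\<close>. This
    contradicts the choice of \<open>m\<close>.\<close>
  have "Poly_Mapping.lookup (u * p) m = Poly_Mapping.lookup u 0 * Poly_Mapping.lookup p m"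
  proof (rule lookup_mult_constant_part, rule notI)
    fix a b assume ab: "a \<in> Poly_Mapping.keys u" "b \<in> Poly_Mapping.keys p" "a \<noteq> 0" "m = a + b"
    have a: "a \<in> monomials V"
      using ab u by (auto simp: poly_on_def)
    moreover obtain v where "v \<in> Poly_Mapping.keys a"
      using \<open>a \<noteq> 0\<close> keys_eq_empty[of a] by blast
    ultimately have "v \<in> V" "Poly_Mapping.lookup a v \<noteq> 0"
      by (auto simp: monomials_def in_keys_iff)
    then have "0 < deg a"
      using \<open>finite V\<close> by (auto simp: deg_def intro!: sum_pos2)
    then have "deg b < deg m"
      using ab by (simp add: deg_def lookup_add sum.distrib)
    moreover have "b \<notin> A"
      using A a m ab by (auto simp: monomial_ideal_def add.commute)
    ultimately show False
      using least[of b] ab by auto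
  qed
  then have "m \<in> Poly_Mapping.keys (u * p)"
    using m u0 by (simp add: in_keys_iff)
  then show False
    using m up by (auto simp: poly_on_def)
qed

section \<open>Products and powers of monomial ideals\<close>

lemma ideal_prod_poly_on:
  fixes R :: "(('v \<Rightarrow>\<^sub>0 nat) \<Rightarrow>\<^sub>0 'k::field) ring"
  assumes "R = type_subring S"
  shows "ideal_prod R (poly_on A) (poly_on B) = poly_on {a + b | a b. a \<in> A \<and> b \<in> B}"
proof
  show "ideal_prod R (poly_on A) (poly_on B) \<subseteq> poly_on {a + b | a b. a \<in> A \<and> b \<in> B}"
  proof
    fix p assume "p \<in> ideal_prod R (poly_on A) (poly_on B)"
    then show "p \<in> poly_on {a + b | a b. a \<in> A \<and> b \<in> B}"
      by induction (auto simp: assms intro: poly_on_closed mult_in_poly_on)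
  qed
  \<comment> \<open>A term with exponent \<open>a + b\<close> is a product of one term from each
    side; the coefficient goes to the first factor.\<close>
  show "poly_on {a + b | a b. a \<in> A \<and> b \<in> B} \<subseteq> ideal_prod R (poly_on A) (poly_on B)"
  proof (rule poly_on_subsetI)
    show "0 \<in> ideal_prod R (poly_on A) (poly_on B)"
      using ideal_prod.prod[of 0 "poly_on A" 0 "poly_on B" R] by (simp add: assms poly_on_closed)
    show "p + q \<in> ideal_prod R (poly_on A) (poly_on B)"
      if "p \<in> ideal_prod R (poly_on A) (poly_on B)" "q \<in> ideal_prod R (poly_on A) (poly_on B)" for p q
      using ideal_prod.sum[OF that] by (simp add: assms)
    show "Poly_Mapping.single m c \<in> ideal_prod R (poly_on A) (poly_on B)"
      if m: "m \<in> {a + b | a b. a \<in> A \<and> b \<in> B}" for m and c :: 'k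
    proof -
      obtain a b where ab: "m = a + b" "a \<in> A" "b \<in> B"
        using m by blast
      then have "Poly_Mapping.single a c \<in> poly_on A" "Poly_Mapping.single b (1::'k) \<in> poly_on B"
        by (auto simp: poly_on_def)
      from ideal_prod.prod[OF this, of R] show ?thesis
        by (simp add: assms mult_single ab)
    qed
  qed
qed

lemma monomial_ideal_power_monomials:
  assumes "G \<subseteq> monomials V"
  shows "monomial_ideal V (power_monomials V G s)"
proof (induction s)
  case (Suc s)
  have "a + e + b \<in> power_monomials V G (Suc s)"
    if "a \<in> power_monomials V G s" "e \<in> G" "b \<in> monomials V" for a e b
  proof -
    have "a + e + b = (a + b) + e" "a + b \<in> power_monomials V G s"
      using Suc that by (simp_all add: monomial_ideal_def ac_simps)
    then show ?thesis
      using \<open>e \<in> G\<close> by auto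
  qed
  then show ?case
    using Suc assms by (auto simp: monomial_ideal_def)
qed (simp add: monomial_ideal_def)

lemma power_monomials_1: "power_monomials V G 1 = {a + e | a e. a \<in> monomials V \<and> e \<in> G}"
  by simp

lemma generator_in_power_monomials: "e \<in> G \<Longrightarrow> e \<in> power_monomials V G 1"
  unfolding power_monomials_1 using zero_in_monomials[of V] by (metis (mono_tags, lifting) add_0 mem_Collect_eq)

text \<open>The recursion multiplies by generators, a power of an ideal by arbitrary elements of the
  ideal. The two agree because the extra cofactor \<open>c\<close> can be moved into the first
  summand, which absorbs it.\<close>

lemma power_monomials_Suc:
  assumes "G \<subseteq> monomials V"
  shows "power_monomials V G (Suc s)
    = {a + b | a b. a \<in> power_monomials V G s \<and> b \<in> power_monomials V G 1}"
proof -
  have sub: "a + (c + e) \<in> power_monomials V G (Suc s)"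
    if "a \<in> power_monomials V G s" "c \<in> monomials V" "e \<in> G" for a c e
  proof -
    have "a + (c + e) = (a + c) + e" "a + c \<in> power_monomials V G s"
      using that monomial_ideal_power_monomials[OF assms, of s]
      by (simp_all add: monomial_ideal_def ac_simps)
    then show ?thesis
      using \<open>e \<in> G\<close> by auto
  qed
  show ?thesis
  proof (intro equalityI subsetI)
    fix m
    assume "m \<in> power_monomials V G (Suc s)"
    then obtain a e where "m = a + e" "a \<in> power_monomials V G s" "e \<in> G"
      unfolding power_monomials.simps(2) by blast
    with generator_in_power_monomials[OF \<open>e \<in> G\<close>, of V]
    show "m \<in> {a + b | a b. a \<in> power_monomials V G s \<and> b \<in> power_monomials V G 1}"
      by blast
  next
    fix m
    assume "m \<in> {a + b | a b. a \<in> power_monomials V G s \<and> b \<in> power_monomials V G 1}"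
    then obtain a c e where "m = a + (c + e)" "a \<in> power_monomials V G s" "c \<in> monomials V" "e \<in> G"
      unfolding power_monomials_1 by blast
    then show "m \<in> power_monomials V G (Suc s)"
      using sub by blast
  qed
qed

lemma genideal_monomials:
  assumes "G \<subseteq> monomials V"
  shows "genideal (mpoly_ring V) ((\<lambda>e. Poly_Mapping.single e (1::'k::field)) ` G)
    = poly_on (power_monomials V G 1)"
proof
  let ?R = "type_subring (poly_on (monomials V) :: (_ \<Rightarrow>\<^sub>0 'k) set)"
  interpret cring ?R by (rule cring_mpoly_ring)
  have gens: "(\<lambda>e. Poly_Mapping.single e (1::'k)) ` G \<subseteq> poly_on (power_monomials V G 1)"
    using generator_in_power_monomials[of _ G V] by auto
  then show "genideal (mpoly_ring V) ((\<lambda>e. Poly_Mapping.single e (1::'k)) ` G)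
      \<subseteq> poly_on (power_monomials V G 1)"
    unfolding mpoly_ring_eq
    by (intro genideal_minimal ideal_poly_on monomial_ideal_power_monomials assms)
  let ?I = "genideal ?R ((\<lambda>e. Poly_Mapping.single e (1::'k)) ` G)"
  have sub: "(\<lambda>e. Poly_Mapping.single e (1::'k)) ` G \<subseteq> carrier ?R"
    using assms by auto
  interpret I: ideal ?I ?R
    by (rule genideal_ideal[OF sub])
  have "Poly_Mapping.single m c \<in> ?I" if "m \<in> power_monomials V G 1" for m and c :: 'k
  proof -
    obtain a e where m: "m = a + e" "a \<in> monomials V" "e \<in> G"
      using \<open>m \<in> power_monomials V G 1\<close> by auto
    then have "Poly_Mapping.single a c \<in> poly_on (monomials V)" "Poly_Mapping.single e 1 \<in> ?I"
      using genideal_self[OF sub] by (auto simp: poly_on_def)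
    then have "Poly_Mapping.single a c * Poly_Mapping.single e 1 \<in> ?I"
      using I.I_l_closed[of "Poly_Mapping.single e 1" "Poly_Mapping.single a c"] by simp
    then show ?thesis
      by (simp add: mult_single m)
  qed
  then have "poly_on (power_monomials V G 1) \<subseteq> ?I"
    using I.zero_closed I.a_closed by (intro poly_on_subsetI) auto
  then show "poly_on (power_monomials V G 1)
      \<subseteq> genideal (mpoly_ring V) ((\<lambda>e. Poly_Mapping.single e (1::'k)) ` G)"
    by (simp add: mpoly_ring_eq)
qed

lemma ideal_power_poly_on:
  assumes "G \<subseteq> monomials V"
  shows "ideal_power (mpoly_ring V) (poly_on (power_monomials V G 1) :: (_ \<Rightarrow>\<^sub>0 'k::field) set) s
    = poly_on (power_monomials V G s)"
proof (induction s)
  case 0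
  then show ?case
    by (simp add: ideal_power_def mpoly_ring_eq ideals_set_def nat_pow_def)
next
  case (Suc s)
  then show ?case
    using ideal_prod_poly_on[OF mpoly_ring_eq[of V]] power_monomials_Suc[OF assms, of s]
    by (simp add: ideal_power_def ideals_set_def nat_pow_def del: power_monomials.simps)
qed

section \<open>Symbolic powers of monomial ideals\<close>

lemma Var_power: "Var v ^ k = Poly_Mapping.single (Poly_Mapping.single v k) 1"
  by (induction k) (simp_all add: Var_def mult_single single_add[symmetric])

text \<open>The localization criterion eliminates fractions: each associated prime only asks for a
  multiplier outside it. Membership is henceforth decided by exhibiting or cancelling such a
  multiplier.\<close>

lemma symbolic_power_poly_on_iff:
  fixes f :: "('v::linorder \<Rightarrow>\<^sub>0 nat) \<Rightarrow>\<^sub>0 'k::field"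
  assumes "G \<subseteq> monomials V"
  defines "R \<equiv> mpoly_ring V" and "I \<equiv> poly_on (power_monomials V G 1)"
  shows "f \<in> symbolic_power R I s \<longleftrightarrow> f \<in> poly_on (monomials V) \<and>
    (\<forall>P \<in> assoc_primes R I. \<exists>u \<in> poly_on (monomials V) - P. u * f \<in> poly_on (power_monomials V G s))"
proof -
  have "to_fract f \<in> genideal (localization R P) (to_fract ` ideal_power R I s) \<longleftrightarrow>
    (\<exists>u \<in> poly_on (monomials V) - P. u * f \<in> poly_on (power_monomials V G s))"
    if "P \<in> assoc_primes R I" "f \<in> poly_on (monomials V)" for P
  proof -
    have "primeideal P (type_subring (poly_on (monomials V)))"
      using that by (simp add: assoc_primes_def R_def mpoly_ring_eq)
    from to_fract_mem_localized_ideal_iff[OF this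
        ideal_poly_on[OF monomial_ideal_power_monomials[OF assms(1)]] that(2)]
    show ?thesis
      unfolding R_def I_def ideal_power_poly_on[OF assms(1)] by (simp add: mpoly_ring_eq)
  qed
  moreover have "carrier R = poly_on (monomials V)"
    by (simp add: R_def mpoly_ring_eq)
  ultimately show ?thesis
    by (auto simp: symbolic_power_def)
qed

text \<open>If \<open>P = I : g\<close>, then any monomial of \<open>g\<close> outside the monomial ideal \<open>I\<close> will do.\<close>

lemma assoc_prime_monomial_witness:
  fixes P :: "(('v \<Rightarrow>\<^sub>0 nat) \<Rightarrow>\<^sub>0 'k::field) set"
  assumes "P \<in> assoc_primes (mpoly_ring V) (poly_on A)"
  obtains b where "b \<in> monomials V" "b \<notin> A" "\<And>v. Var v \<in> P \<Longrightarrow> Poly_Mapping.single v 1 + b \<in> A"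
proof -
  let ?R = "type_subring (poly_on (monomials V) :: (_ \<Rightarrow>\<^sub>0 'k) set)"
  from assms obtain g where P: "primeideal P ?R" and g: "g \<in> poly_on (monomials V)"
    and P_eq: "P = {r \<in> poly_on (monomials V). r * g \<in> poly_on A}"
    by (auto simp: assoc_primes_def mpoly_ring_eq)
  interpret primeideal P ?R by fact
  have "(1 :: _ \<Rightarrow>\<^sub>0 'k) \<in> poly_on (monomials V)"
    using one_closed by simp
  moreover have "1 \<notin> P"
    using one_imp_carrier I_notcarr by auto
  ultimately obtain b where b: "b \<in> Poly_Mapping.keys g" "b \<notin> A"
    by (auto simp: P_eq poly_on_def)
  have "Poly_Mapping.single v 1 + b \<in> A" if "Var v \<in> P" for v
  proof -
    \<comment> \<open>Multiplying by a variable shifts exponents injectively, so no monomial of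
      \<open>g\<close> is lost by cancellation.\<close>
    have "Poly_Mapping.single v 1 + b \<in> Poly_Mapping.keys (Var v * g)"
      using b by (simp add: in_keys_iff Var_def lookup_single_mult)
    then show ?thesis
      using that by (auto simp: P_eq poly_on_def)
  qed
  moreover have "b \<in> monomials V"
    using b g by (auto simp: poly_on_def)
  ultimately show thesis
    using b that by blast
qed

lemma Var_in_prime:
  assumes "primeideal P (type_subring (poly_on (monomials V)))" "v \<in> V"
    and "Var v ^ k \<in> (P :: (_ \<Rightarrow>\<^sub>0 'k::field) set)"
  shows "Var v \<in> P"
  using assms(3)
proof (induction k)
  case 0
  then show ?case
    using assms(1) ideal.one_imp_carrier[of P "type_subring (poly_on (monomials V))"]
    by (auto simp: primeideal_def primeideal_axioms_def)
next
  case (Suc k)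
  have "Var v \<in> poly_on (monomials V)" "Var v ^ k \<in> poly_on (monomials V)"
    using assms(2) unfolding Var_power by (simp_all add: Var_def)
  then show ?case
    using primeideal.I_prime[OF assms(1), of "Var v" "Var v ^ k"] Suc by auto
qed

text \<open>The hypotheses say that \<open>I : \<gamma>\<close> is the maximal ideal of the origin.\<close>

lemma symbolic_power_eq_if_maximal_ideal_associated:
  fixes V :: "'v::linorder set"
  assumes "finite V" and G: "G \<subseteq> monomials V"
    and \<gamma>: "\<gamma> \<in> monomials V" "\<gamma> \<notin> power_monomials V G 1"
    and socle: "\<And>v. v \<in> V \<Longrightarrow> Poly_Mapping.single v 1 + \<gamma> \<in> power_monomials V G 1"
  defines "I \<equiv> poly_on (power_monomials V G 1) :: (('v \<Rightarrow>\<^sub>0 nat) \<Rightarrow>\<^sub>0 'k::field) set"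
  shows "symbolic_power (mpoly_ring V) I s = ideal_power (mpoly_ring V) I s"
proof -
  let ?S = "poly_on (monomials V) :: (('v \<Rightarrow>\<^sub>0 nat) \<Rightarrow>\<^sub>0 'k) set"
  \<comment> \<open>\<open>P\<close> is the maximal ideal of the origin: the polynomials without
    constant term.\<close>
  define P where "P = {p \<in> ?S. Poly_Mapping.lookup p 0 = 0}"
  note mon = monomial_ideal_power_monomials[OF G]
  have mult_S: "p * q \<in> ?S" if "p \<in> ?S" "q \<in> ?S" for p q
    using that by (rule mult_in_poly_on) simp
  interpret cring "type_subring ?S"
    by (rule cring_mpoly_ring)
  have "ideal P (type_subring ?S)"
    by (rule ideal_type_subringI[OF ring_axioms])
      (auto simp: P_def lookup_add lookup_mult_zero intro: poly_on_closed mult_S)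
  moreover have one: "1 \<in> ?S - P"
    using one_closed by (auto simp: P_def)
  then have "carrier (type_subring ?S) \<noteq> P"
    by auto
  ultimately have prime: "primeideal P (type_subring ?S)"
    using cring_mpoly_ring by (intro primeidealI) (auto simp: P_def lookup_mult_zero)
  define g where "g = Poly_Mapping.single \<gamma> (1::'k)"
  have g: "g \<in> ?S" "g \<notin> I"
    using \<gamma> by (simp_all add: g_def I_def del: power_monomials.simps)
  have "P = {r \<in> ?S. r * g \<in> I}"
  proof (intro equalityI subsetI)
    fix r assume r: "r \<in> P"
    \<comment> \<open>A monomial of \<open>r\<close> is not constant, so some variable
      \<open>v\<close> divides it; \<open>socle\<close> puts \<open>v\<close> times
      \<open>\<gamma>\<close> into the ideal, and the remaining cofactor \<open>a'\<close> is
      absorbed.\<close>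
    have "a + \<gamma> \<in> power_monomials V G 1" if "a \<in> Poly_Mapping.keys r" for a
    proof -
      have "a \<noteq> 0" "a \<in> monomials V"
        using that r by (auto simp: P_def in_keys_iff poly_on_def)
      then obtain v where v: "v \<in> Poly_Mapping.keys a" "v \<in> V"
        unfolding monomials_def using keys_eq_empty[of a] by blast
      define a' where "a' = a - Poly_Mapping.single v 1"
      have a: "a = a' + Poly_Mapping.single v 1"
        using v by (intro poly_mapping_eqI)
          (auto simp: a'_def lookup_add lookup_minus lookup_single when_def in_keys_iff)
      then have "a' \<in> monomials V"
        using \<open>a \<in> monomials V\<close> by simp
      then have "(Poly_Mapping.single v 1 + \<gamma>) + a' \<in> power_monomials V G 1"
        using mon[of 1] socle[OF v(2)] unfolding monomial_ideal_def by blast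
      then show ?thesis
        by (simp add: a ac_simps del: power_monomials.simps)
    qed
    then have "r * g \<in> I"
      unfolding I_def by (intro mult_in_poly_on[where A = "Poly_Mapping.keys r" and B = "{\<gamma>}"])
        (auto simp: poly_on_def g_def)
    then show "r \<in> {r \<in> ?S. r * g \<in> I}"
      using r by (simp add: P_def)
  next
    \<comment> \<open>A nonzero constant term of \<open>r\<close> could be cancelled, which would
      put \<open>g\<close> into \<open>I\<close>.\<close>
    fix r assume "r \<in> {r \<in> ?S. r * g \<in> I}"
    then show "r \<in> P"
      using poly_on_cancel_unit[OF \<open>finite V\<close> mon[of 1] g(1), of r] g(2)
      by (auto simp: P_def I_def)
  qed
  then have "P \<in> assoc_primes (mpoly_ring V) I"
    using prime g(1) by (auto simp: assoc_primes_def mpoly_ring_eq)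
  \<comment> \<open>Multipliers outside \<open>P\<close> have nonzero constant term, so the same
    cancellation brings \<open>f\<close> back into the ordinary power.\<close>
  moreover have "f \<in> poly_on (power_monomials V G s)"
    if "u \<in> ?S - P" "u * f \<in> poly_on (power_monomials V G s)" "f \<in> ?S" for u f
    using poly_on_cancel_unit[OF \<open>finite V\<close> mon that(3) _ _ that(2)] that(1) by (auto simp: P_def)
  ultimately have "symbolic_power (mpoly_ring V) I s \<subseteq> poly_on (power_monomials V G s)"
    unfolding I_def using symbolic_power_poly_on_iff[OF G] by blast
  \<comment> \<open>For the other inclusion the multiplier 1 serves every associated prime.\<close>
  moreover have "poly_on (power_monomials V G s) \<subseteq> symbolic_power (mpoly_ring V) I s"
  proof
    fix f :: "_ \<Rightarrow>\<^sub>0 'k" assume f: "f \<in> poly_on (power_monomials V G s)"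
    then have "f \<in> ?S"
      using mon[of s] by (auto simp: poly_on_def monomial_ideal_def)
    moreover have "1 \<notin> Q" if "Q \<in> assoc_primes (mpoly_ring V) I" for Q
      using that ideal.one_imp_carrier[of Q "type_subring ?S"]
      by (auto simp: assoc_primes_def mpoly_ring_eq primeideal_def primeideal_axioms_def)
    ultimately show "f \<in> symbolic_power (mpoly_ring V) I s"
      unfolding I_def symbolic_power_poly_on_iff[OF G] using f one
      by (auto intro!: bexI[of _ 1])
  qed
  ultimately show ?thesis
    unfolding I_def ideal_power_poly_on[OF G] by blast
qed

subsection \<open>Edge ideals\<close>

definition edge_monomial :: "'v wograph \<Rightarrow> 'v \<times> 'v \<Rightarrow> 'v \<Rightarrow>\<^sub>0 nat" where
  "edge_monomial D = (\<lambda>(x, y). Poly_Mapping.single x 1 + Poly_Mapping.single y (weight D y))"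

abbreviation edge_monomials :: "'v wograph \<Rightarrow> ('v \<Rightarrow>\<^sub>0 nat) set" where
  "edge_monomials D \<equiv> edge_monomial D ` edges D"

context weighted_oriented_graph
begin

lemma edge_monomials_subset: "edge_monomials D \<subseteq> monomials (verts D)"
  using edges_subset by (auto simp: edge_monomial_def)

lemma edge_ideal_eq:
  "(edge_ideal D :: (('v \<Rightarrow>\<^sub>0 nat) \<Rightarrow>\<^sub>0 'k::field) set)
    = poly_on (power_monomials (verts D) (edge_monomials D) 1)"
proof -
  have "Var x * Var y ^ weight D y = Poly_Mapping.single (edge_monomial D (x, y)) (1::'k)" for x y
    unfolding Var_power by (simp add: Var_def mult_single edge_monomial_def)
  then have "{Var x * Var y ^ weight D y | x y. (x, y) \<in> edges D}
      = (\<lambda>e. Poly_Mapping.single e (1::'k)) ` edge_monomials D"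
    by (auto simp: image_iff)
  then show ?thesis
    unfolding edge_ideal_def by (simp only: genideal_monomials[OF edge_monomials_subset])
qed

lemma edge_distinct: "(x, y) \<in> edges D \<Longrightarrow> x \<noteq> y"
  using no_loops by auto

text \<open>Divisibility by a generator, read off exponents: the ends of an edge are distinct, so
  the two bounds can be checked separately.\<close>

lemma power_monomials_edge_iff:
  "m \<in> power_monomials (verts D) (edge_monomials D) 1 \<longleftrightarrow> m \<in> monomials (verts D) \<and>
    (\<exists>(x, y) \<in> edges D. 1 \<le> Poly_Mapping.lookup m x \<and> weight D y \<le> Poly_Mapping.lookup m y)"
    (is "?L \<longleftrightarrow> ?R")
proof
  assume ?L
  then show ?R
    using edge_monomials_subset
    by (fastforce simp: edge_monomial_def lookup_add lookup_single when_def)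
next
  assume ?R
  then obtain x y where m: "m \<in> monomials (verts D)" and xy: "(x, y) \<in> edges D"
    "1 \<le> Poly_Mapping.lookup m x" "weight D y \<le> Poly_Mapping.lookup m y"
    by auto
  have "m = (m - edge_monomial D (x, y)) + edge_monomial D (x, y)"
    using xy edge_distinct[OF xy(1)] by (intro poly_mapping_eqI)
      (auto simp: edge_monomial_def lookup_add lookup_minus lookup_single when_def)
  moreover from this have "m - edge_monomial D (x, y) \<in> monomials (verts D)"
    using m monomials_add_iff by metis
  ultimately show ?L
    unfolding power_monomials_1 using xy(1) by blast
qed

text \<open>Were all three variables in \<open>P\<close>, a monomial \<open>\<beta>\<close> outside
  the ideal would enter it on multiplication by each of \<open>b\<close>, \<open>c\<close>,
  \<open>d\<close>. For \<open>b\<close> this forces exponent 0 at \<open>b\<close>; hence for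
  \<open>c\<close> the edge \<open>(c, d)\<close> is responsible, giving exponent 0 at
  \<open>c\<close> and at least \<open>weight D d\<close> at \<open>d\<close>; then no edge is left
  for \<open>d\<close>.\<close>

lemma assoc_prime_avoids_path:
  fixes P :: "(('v \<Rightarrow>\<^sub>0 nat) \<Rightarrow>\<^sub>0 'k::field) set"
  assumes "P \<in> assoc_primes (mpoly_ring (verts D)) (edge_ideal D)"
    and path: "(b, c) \<in> edges D" "(c, d) \<in> edges D" and "weight D b = 1"
    and in_c: "\<And>x. (x, c) \<in> edges D \<Longrightarrow> x = b"
    and in_d: "\<And>x. (x, d) \<in> edges D \<Longrightarrow> x = c"
    and out_c: "\<And>y. (c, y) \<in> edges D \<Longrightarrow> y = d"
  shows "Var b \<notin> P \<or> Var c \<notin> P \<or> Var d \<notin> P"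
proof (rule ccontr)
  assume "\<not> ?thesis"
  moreover obtain \<beta> where \<beta>: "\<beta> \<in> monomials (verts D)"
    "\<beta> \<notin> power_monomials (verts D) (edge_monomials D) 1"
    "\<And>v. Var v \<in> P \<Longrightarrow> Poly_Mapping.single v 1 + \<beta> \<in> power_monomials (verts D) (edge_monomials D) 1"
    using assms(1) assoc_prime_monomial_witness unfolding edge_ideal_eq by metis
  ultimately have socle: "\<exists>(x, y) \<in> edges D. 1 \<le> Poly_Mapping.lookup (Poly_Mapping.single v 1 + \<beta>) x
      \<and> weight D y \<le> Poly_Mapping.lookup (Poly_Mapping.single v 1 + \<beta>) y"
    if "v \<in> {b, c, d}" for v
    using that unfolding power_monomials_edge_iff by blast
  have not: "\<not> (1 \<le> Poly_Mapping.lookup \<beta> x \<and> weight D y \<le> Poly_Mapping.lookup \<beta> y)"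
    if "(x, y) \<in> edges D" for x y
    using \<beta>(1,2) that unfolding power_monomials_edge_iff by blast
  \<comment> \<open>Only the exponent of \<open>v\<close> has changed, so the edge whose generator
    now divides must contain \<open>v\<close>: as tail with exponent previously 0, or as head with
    exponent previously below its weight.\<close>
  have socle': "(\<exists>y. (v, y) \<in> edges D \<and> Poly_Mapping.lookup \<beta> v = 0 \<and> weight D y \<le> Poly_Mapping.lookup \<beta> y)
      \<or> (\<exists>x. (x, v) \<in> edges D \<and> 1 \<le> Poly_Mapping.lookup \<beta> x \<and> Poly_Mapping.lookup \<beta> v < weight D v)"
    if v: "v \<in> {b, c, d}" for v
  proof -
    obtain x y where xy: "(x, y) \<in> edges D"
      "1 \<le> Poly_Mapping.lookup (Poly_Mapping.single v 1 + \<beta>) x"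
      "weight D y \<le> Poly_Mapping.lookup (Poly_Mapping.single v 1 + \<beta>) y"
      using socle[OF v] by auto
    then have "x = v \<and> Poly_Mapping.lookup \<beta> v = 0 \<and> weight D y \<le> Poly_Mapping.lookup \<beta> y
        \<or> y = v \<and> 1 \<le> Poly_Mapping.lookup \<beta> x \<and> Poly_Mapping.lookup \<beta> v < weight D v"
      using not[OF xy(1)] edge_distinct[OF xy(1)]
      by (auto simp: lookup_add lookup_single when_def split: if_splits)
    then show ?thesis
      using xy(1) by blast
  qed
  \<comment> \<open>As \<open>weight D b = 1\<close>, both alternatives of \<open>socle'\<close> say
    that \<open>b\<close> does not divide \<open>\<beta>\<close>.\<close>
  have "Poly_Mapping.lookup \<beta> b = 0"
    using socle'[of b] \<open>weight D b = 1\<close> by auto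
  then have c: "Poly_Mapping.lookup \<beta> c = 0" and "weight D d \<le> Poly_Mapping.lookup \<beta> d"
    using socle'[of c] in_c out_c by fastforce+
  moreover have "1 \<le> weight D d"
    using weight_pos edges_subset path by blast
  ultimately show False
    using socle'[of d] in_d by fastforce
qed

end

section \<open>The monomial separating the symbolic cube from the cube\<close>

lemma power_monomials_3_iff:
  "m \<in> power_monomials V G 3 \<longleftrightarrow>
    (\<exists>r e1 e2 e3. m = r + e1 + e2 + e3 \<and> r \<in> monomials V \<and> e1 \<in> G \<and> e2 \<in> G \<and> e3 \<in> G)"
  by (simp add: numeral_3_eq_3) blast

lemma symbolic_cube_ne_cube:
  fixes D :: "'v::linorder wograph"
  assumes D: "weighted_oriented_graph D"
    and path: "(p, a) \<in> edges D" "(a, b) \<in> edges D" "(b, c) \<in> edges D" "(c, d) \<in> edges D"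
    and dist: "distinct [p, a, b, c, d]"
    and out: "\<And>x y z. (x, y) \<in> edges D \<Longrightarrow> (x, z) \<in> edges D \<Longrightarrow> y = z"
    and inn: "\<And>x y z. (x, z) \<in> edges D \<Longrightarrow> (y, z) \<in> edges D \<Longrightarrow> x = y"
    and a: "2 \<le> weight D a" and b: "weight D b = 1"
  shows "symbolic_power (mpoly_ring (verts D)) (edge_ideal D) 3
    \<noteq> ideal_power (mpoly_ring (verts D) :: (('v \<Rightarrow>\<^sub>0 nat) \<Rightarrow>\<^sub>0 'k::field) ring) (edge_ideal D) 3"
proof -
  interpret weighted_oriented_graph D by fact
  let ?V = "verts D" and ?G = "edge_monomials D"
  let ?S = "poly_on (monomials ?V) :: (('v \<Rightarrow>\<^sub>0 nat) \<Rightarrow>\<^sub>0 'k) set"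
  let ?x = "Poly_Mapping.single :: 'v \<Rightarrow> nat \<Rightarrow> _"
  have V: "p \<in> ?V" "a \<in> ?V" "b \<in> ?V" "c \<in> ?V" "d \<in> ?V"
    using path edges_subset by auto
  have c: "1 \<le> weight D c"
    using weight_pos V by auto
  define \<phi> where "\<phi> = ?x p 1 + ?x a (weight D a) + ?x b 2 + ?x c (weight D c)"
  define f where "f = Poly_Mapping.single \<phi> (1::'k)"
  have \<phi>: "\<phi> \<in> monomials ?V"
    using V by (simp add: \<phi>_def)
  then have f: "f \<in> ?S"
    by (simp add: f_def)

  have "\<phi> \<notin> power_monomials ?V ?G 3"
  proof
    assume "\<phi> \<in> power_monomials ?V ?G 3"
    then obtain r e1 e2 e3 where \<phi>_eq: "\<phi> = r + e1 + e2 + e3" and e: "e1 \<in> ?G" "e2 \<in> ?G" "e3 \<in> ?G"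
      unfolding power_monomials_3_iff by blast
    \<comment> \<open>An edge whose generator divides \<open>f\<close> has both ends among
      \<open>p, a, b, c\<close>. Out-neighbours are unique and that of \<open>c\<close> is
      \<open>d\<close>, so three edges remain.\<close>
    have "e \<in> {edge_monomial D (p, a), edge_monomial D (a, b), edge_monomial D (b, c)}"
      if e: "e \<in> ?G" and le: "\<And>v. Poly_Mapping.lookup e v \<le> Poly_Mapping.lookup \<phi> v" for e
    proof -
      obtain x y where xy: "e = edge_monomial D (x, y)" "(x, y) \<in> edges D"
        using e by auto
      have "x \<noteq> y" "1 \<le> weight D y"
        using xy edge_distinct weight_pos edges_subset by auto
      then have "Poly_Mapping.lookup \<phi> x \<noteq> 0" "Poly_Mapping.lookup \<phi> y \<noteq> 0"
        using le[of x] le[of y] by (auto simp: xy edge_monomial_def lookup_add lookup_single when_def)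
      then have "x \<in> {p, a, b, c}" "y \<in> {p, a, b, c}"
        by (auto simp: \<phi>_def lookup_add lookup_single when_def split: if_splits)
      then have "(x, y) \<in> {(p, a), (a, b), (b, c)}"
        using out[OF xy(2)] path dist by auto
      then show ?thesis
        by (auto simp: xy)
    qed
    note cases = this
    have "e1 \<in> {edge_monomial D (p, a), edge_monomial D (a, b), edge_monomial D (b, c)}"
      "e2 \<in> {edge_monomial D (p, a), edge_monomial D (a, b), edge_monomial D (b, c)}"
      "e3 \<in> {edge_monomial D (p, a), edge_monomial D (a, b), edge_monomial D (b, c)}"
      by (rule cases; use e in \<open>simp add: \<phi>_eq lookup_add\<close>)+
    \<comment> \<open>The exponent of \<open>p\<close> allows \<open>e(p,a)\<close> at most once.
      Without it, three factors \<open>e(a,b)\<close> or \<open>e(b,c)\<close> give \<open>b\<close>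
      exponent 3 instead of 2. With it, \<open>a\<close> is used up, and two factors
      \<open>e(b,c)\<close> exceed the exponent of \<open>c\<close>.\<close>
    moreover have "Poly_Mapping.lookup (e1 + e2 + e3) v \<le> Poly_Mapping.lookup \<phi> v" for v
      by (simp add: \<phi>_eq lookup_add)
    note this[of p] this[of a] this[of b] this[of c]
    ultimately show False
      using dist a b c
      by (auto simp: \<phi>_def edge_monomial_def lookup_add lookup_single when_def)
  qed
  then have "f \<notin> ideal_power (mpoly_ring ?V) (edge_ideal D) 3"
    unfolding edge_ideal_eq ideal_power_poly_on[OF edge_monomials_subset] by (simp add: f_def)

  moreover have "f \<in> symbolic_power (mpoly_ring ?V) (edge_ideal D) 3"
  proof -
    let ?e = "edge_monomial D"
    have G: "?e (p, a) \<in> ?G" "?e (a, b) \<in> ?G" "?e (b, c) \<in> ?G" "?e (c, d) \<in> ?G"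
      using path by auto
    have "\<exists>u \<in> ?S - P. u * f \<in> poly_on (power_monomials ?V ?G 3)"
      if P: "P \<in> assoc_primes (mpoly_ring ?V) (edge_ideal D)" for P
    proof -
      have prime: "primeideal P (type_subring ?S)"
        using P by (simp add: assoc_primes_def mpoly_ring_eq)
      have "Var b \<notin> P \<or> Var c \<notin> P \<or> Var d \<notin> P"
        using assoc_prime_avoids_path[OF P path(3,4) b] inn out path by blast
      \<comment> \<open>The multipliers are pure powers, which stay outside a prime when the
        variable does.\<close>
      then have "Var b ^ 1 \<notin> P \<or> Var c ^ weight D c \<notin> P \<or> Var d ^ weight D d \<notin> P"
        using Var_in_prime[OF prime] V by blast
      then obtain v k where v: "Var v ^ k \<notin> P" "v \<in> ?V"
        and vk: "(v, k) \<in> {(b, 1), (c, weight D c), (d, weight D d)}"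
        using V by blast
      \<comment> \<open>Since \<open>weight D b = 1\<close>, \<open>e(a,b) = a b\<close>; its square
        costs \<open>a\<close> exponent 2, which \<open>2 \<le> weight D a\<close> provides, so the
        subtraction in the cofactor is exact.\<close>
      have b3: "?x b 1 + \<phi> = (?x p 1 + ?x a (weight D a - 2)) + ?e (a, b) + ?e (a, b) + ?e (b, c)"
        using a b by (intro poly_mapping_eqI)
          (auto simp: \<phi>_def edge_monomial_def lookup_add lookup_single when_def)
      have c3: "?x c (weight D c) + \<phi> = 0 + ?e (p, a) + ?e (b, c) + ?e (b, c)"
        by (intro poly_mapping_eqI)
          (auto simp: \<phi>_def edge_monomial_def lookup_add lookup_single when_def)
      have d3: "?x d (weight D d) + \<phi> = (?x p 1 + ?x a (weight D a - 2) + ?x c (weight D c - 1))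
          + ?e (a, b) + ?e (a, b) + ?e (c, d)"
        using a b c by (intro poly_mapping_eqI)
          (auto simp: \<phi>_def edge_monomial_def lookup_add lookup_single when_def)
      have "?x b 1 + \<phi> \<in> power_monomials ?V ?G 3"
        unfolding power_monomials_3_iff b3 using G V
        by (intro exI conjI) (rule refl, auto)
      moreover have "?x c (weight D c) + \<phi> \<in> power_monomials ?V ?G 3"
        unfolding power_monomials_3_iff c3 using G V
        by (intro exI conjI) (rule refl, auto)
      moreover have "?x d (weight D d) + \<phi> \<in> power_monomials ?V ?G 3"
        unfolding power_monomials_3_iff d3 using G V
        by (intro exI conjI) (rule refl, auto)
      ultimately have "?x v k + \<phi> \<in> power_monomials ?V ?G 3"
        using vk by auto
      then have "Var v ^ k * f \<in> poly_on (power_monomials ?V ?G 3)"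
        by (simp add: Var_power f_def mult_single)
      moreover have "Var v ^ k \<in> ?S"
        using v by (simp add: Var_power)
      ultimately show ?thesis
        using v by blast
    qed
    then show ?thesis
      using f symbolic_power_poly_on_iff[OF edge_monomials_subset, of f 3]
      unfolding edge_ideal_eq by blast
  qed
  ultimately show ?thesis
    by auto
qed

section \<open>Edge ideals all of whose weights are at least 2\<close>

lemma edge_ideal_symbolic_power_eq:
  fixes D :: "'v::linorder wograph"
  assumes "weighted_oriented_graph D"
    and pred: "\<And>v. v \<in> verts D \<Longrightarrow> \<exists>u. (u, v) \<in> edges D"
    and w: "\<And>v. v \<in> verts D \<Longrightarrow> 2 \<le> weight D v"
  shows "symbolic_power (mpoly_ring (verts D)) (edge_ideal D) s
    = ideal_power (mpoly_ring (verts D) :: (('v \<Rightarrow>\<^sub>0 nat) \<Rightarrow>\<^sub>0 'k::field) ring) (edge_ideal D) s"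
proof -
  interpret weighted_oriented_graph D by fact
  \<comment> \<open>In \<open>\<gamma>\<close> every head of an edge falls one short of its weight,
    so no generator divides. Multiplying by \<open>v\<close> completes an edge
    \<open>(u, v)\<close>: its tail \<open>u\<close> already occurs, as
    \<open>weight D u - 1 \<ge> 1\<close>.\<close>
  define \<gamma> where "\<gamma> = (\<Sum>v\<in>verts D. Poly_Mapping.single v (weight D v - 1))"
  have lookup: "Poly_Mapping.lookup \<gamma> v = (if v \<in> verts D then weight D v - 1 else 0)" for v
    by (simp add: \<gamma>_def lookup_sum lookup_single when_def finite_verts sum.delta)
  then have \<gamma>: "\<gamma> \<in> monomials (verts D)"
    by (auto simp: monomials_def in_keys_iff split: if_splits)
  have "\<not> weight D y \<le> Poly_Mapping.lookup \<gamma> y" if "(x, y) \<in> edges D" for x y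
    using that w[of y] edges_subset by (auto simp: lookup)
  then have "\<gamma> \<notin> power_monomials (verts D) (edge_monomials D) 1"
    unfolding power_monomials_edge_iff by blast
  moreover have "Poly_Mapping.single v 1 + \<gamma> \<in> power_monomials (verts D) (edge_monomials D) 1"
    if v: "v \<in> verts D" for v
  proof -
    obtain u where u: "(u, v) \<in> edges D"
      using pred[OF v] by auto
    then have "u \<in> verts D"
      using edges_subset by auto
    then show ?thesis
      unfolding power_monomials_edge_iff using u v \<gamma> w[of u] w[of v]
      by (auto intro!: bexI[OF _ u] simp: lookup lookup_add lookup_single)
  qed
  ultimately show ?thesis
    unfolding edge_ideal_eq using finite_verts edge_monomials_subset \<gamma>
    by (intro symbolic_power_eq_if_maximal_ideal_associated)
qed

section \<open>The cycle as a periodic sequence, and the equivalence\<close>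

lemma naturally_oriented_cycleE:
  assumes "naturally_oriented_cycle D xs"
  obtains x :: "nat \<Rightarrow> 'v" where "verts D = range x" "edges D = {(x i, x (Suc i)) | i. True}"
    "\<And>i j. x i = x j \<longleftrightarrow> i mod length xs = j mod length xs"
proof
  \<comment> \<open>Unrolling the cycle to a sequence over all naturals makes the next index plain
    \<open>Suc\<close>; the period appears only in the criterion for equality.\<close>
  let ?n = "length xs" and ?x = "\<lambda>i. xs ! (i mod length xs)"
  have n: "0 < ?n" and "distinct xs" and V: "verts D = set xs"
    and E: "edges D = {(xs ! i, xs ! (Suc i mod ?n)) | i. i < ?n}"
    using assms by (auto simp: naturally_oriented_cycle_def)
  show "verts D = range ?x"
  proof
    show "verts D \<subseteq> range ?x"
    proof
      fix v assume "v \<in> verts D"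
      then obtain i where "i < ?n" "v = xs ! i"
        by (auto simp: V in_set_conv_nth)
      then show "v \<in> range ?x"
        by (intro image_eqI[of _ _ i]) auto
    qed
  qed (use n in \<open>auto simp: V\<close>)
  show "edges D = {(?x i, ?x (Suc i)) | i. True}"
  proof (intro equalityI subsetI)
    fix e assume "e \<in> edges D"
    then obtain i where "i < ?n" "e = (xs ! i, xs ! (Suc i mod ?n))"
      unfolding E by blast
    then have "e = (?x i, ?x (Suc i))"
      by simp
    then show "e \<in> {(?x i, ?x (Suc i)) | i. True}"
      by blast
  next
    fix e assume "e \<in> {(?x i, ?x (Suc i)) | i. True}"
    then obtain i where "e = (?x i, ?x (Suc i))"
      by blast
    then have "e = (xs ! (i mod ?n), xs ! (Suc (i mod ?n) mod ?n))" "i mod ?n < ?n"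
      using n by (simp_all add: mod_Suc_eq)
    then show "e \<in> edges D"
      unfolding E by blast
  qed
  show "?x i = ?x j \<longleftrightarrow> i mod ?n = j mod ?n" for i j
    using n \<open>distinct xs\<close> by (simp add: nth_eq_iff_index_eq)
qed

theorem corollary3p19:
  fixes D :: "'v::linorder wograph" and xs :: "'v list" and n :: nat
  assumes "weighted_oriented_graph D"
    and "naturally_oriented_cycle D xs" and "length xs = n"
    and "even n" and "n \<noteq> 4"
    and "\<exists>v \<in> verts D. weight D v \<noteq> 1"
  shows "(\<forall>s\<ge>2. symbolic_power (mpoly_ring (verts D)) (edge_ideal D) s
            = ideal_power (mpoly_ring (verts D) :: (('v \<Rightarrow>\<^sub>0 nat) \<Rightarrow>\<^sub>0 'k::field) ring) (edge_ideal D) s)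
         \<longleftrightarrow> (\<forall>v \<in> verts D. weight D v \<noteq> 1)"
proof -
  interpret weighted_oriented_graph D by fact
  have "3 \<le> n"
    using assms(2,3) by (simp add: naturally_oriented_cycle_def)
  moreover have "n \<noteq> 3"
    using \<open>even n\<close> by auto
  \<comment> \<open>This bound makes five consecutive vertices distinct, as the path
    \<open>p, a, b, c, d\<close> requires.\<close>
  ultimately have "5 \<le> n"
    using \<open>n \<noteq> 4\<close> by simp
  obtain x :: "nat \<Rightarrow> 'v" where V: "verts D = range x" and E: "edges D = {(x i, x (Suc i)) | i. True}"
    and x_eq: "\<And>i j. x i = x j \<longleftrightarrow> i mod n = j mod n"
    by (rule naturally_oriented_cycleE[OF assms(2), unfolded assms(3)]) (rule that)
  have x_shift: "x (i + n) = x i" for i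
    by (simp add: x_eq)
  \<comment> \<open>Injectivity of the successor on residues, in the shape that
    \<open>mod_Suc\<close> produces.\<close>
  have wrap: "(if Suc p = n then 0 else Suc p) = (if Suc q = n then 0 else Suc q) \<longleftrightarrow> p = q" for p q
    by auto
  have Suc_eq: "x (Suc i) = x (Suc j) \<longleftrightarrow> x i = x j" for i j
    unfolding x_eq mod_Suc[of i] mod_Suc[of j] by (rule wrap)
  show ?thesis
  proof
    assume nontriv: "\<forall>v \<in> verts D. weight D v \<noteq> 1"
    have "2 \<le> weight D v" if "v \<in> verts D" for v
      using weight_pos[OF that] bspec[OF nontriv that] by linarith
    moreover have "\<exists>u. (u, v) \<in> edges D" if v: "v \<in> verts D" for v
    proof -
      obtain i where "v = x i"
        using v V by auto
      \<comment> \<open>Adding \<open>n\<close> first keeps the predecessor index meaningful at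
        \<open>i = 0\<close>.\<close>
      then have "v = x (Suc (i + n - 1))"
        using x_shift[of i] \<open>5 \<le> n\<close> by simp
      then show ?thesis
        unfolding E by blast
    qed
    ultimately show "\<forall>s\<ge>2. symbolic_power (mpoly_ring (verts D)) (edge_ideal D) s
            = ideal_power (mpoly_ring (verts D) :: (('v \<Rightarrow>\<^sub>0 nat) \<Rightarrow>\<^sub>0 'k) ring) (edge_ideal D) s"
      using edge_ideal_symbolic_power_eq[OF assms(1)] by blast
  next
    assume eq: "\<forall>s\<ge>2. symbolic_power (mpoly_ring (verts D)) (edge_ideal D) s
            = ideal_power (mpoly_ring (verts D) :: (('v \<Rightarrow>\<^sub>0 nat) \<Rightarrow>\<^sub>0 'k) ring) (edge_ideal D) s"
    show "\<forall>v \<in> verts D. weight D v \<noteq> 1"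
    proof (rule ccontr)
      assume "\<not> ?thesis"
      then obtain k where k: "weight D (x k) = 1"
        using V by auto
      obtain l where l: "weight D (x l) \<noteq> 1"
        using assms(6) V by auto
      \<comment> \<open>Going round from \<open>l\<close> to \<open>k\<close>, the weight must drop
        to 1 somewhere; otherwise non-triviality would propagate forward and reach
        \<open>k\<close>.\<close>
      have "\<exists>j. weight D (x (Suc j)) \<noteq> 1 \<and> weight D (x (Suc (Suc j))) = 1"
      proof (rule ccontr)
        assume none: "\<not> ?thesis"
        \<comment> \<open>Starting one period after \<open>l\<close> guarantees that each index is a
          successor, as \<open>none\<close> requires.\<close>
        have "weight D (x (l + n + i)) \<noteq> 1" for i
        proof (induction i)
          case 0
          then show ?case
            using l x_shift[of l] by simp
        next
          case (Suc i)
          moreover have "l + n + i = Suc (l + n + i - 1)"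
            using \<open>5 \<le> n\<close> by simp
          ultimately show ?case
            using none by (metis add_Suc_right)
        qed
        \<comment> \<open>The index \<open>k + (l + 1) * n\<close> represents the same vertex as
          \<open>k\<close> and is at least \<open>l + n\<close>, so the propagation reaches
          it.\<close>
        moreover have "l \<le> l * n"
          using \<open>5 \<le> n\<close> by simp
        then have "l + n + (k + l * n - l) = k + (l + 1) * n"
          unfolding add_mult_distrib by linarith
        moreover have "x (k + (l + 1) * n) = x k"
          unfolding x_eq by (rule mod_mult_self1)
        ultimately show False
          using k by metis
      qed
      then obtain j where j: "weight D (x (Suc j)) \<noteq> 1" "weight D (x (Suc (Suc j))) = 1"
        by blast
      \<comment> \<open>\<open>y 0\<close>, ..., \<open>y 4\<close> play the roles of
        \<open>p, a, b, c, d\<close>. Undoing the shift by \<open>j\<close> reduces their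
        distinctness to indices below 5, which are their own residues modulo
        \<open>n\<close>.\<close>
      define y where "y i = x (j + i)" for i
      have "x (j + i) = x (j + i') \<longleftrightarrow> x i = x i'" for i i'
        by (induction j) (simp_all add: Suc_eq)
      then have "y i = y i' \<longleftrightarrow> i = i'" if "i < 5" "i' < 5" for i i'
        using that \<open>5 \<le> n\<close> by (simp add: y_def x_eq)
      then have dist: "distinct [y 0, y 1, y 2, y 3, y 4]"
        by simp
      have "(y i, y (Suc i)) \<in> edges D" for i
        unfolding E y_def by auto
      from this[of 0] this[of 1] this[of 2] this[of 3]
      have path: "(y 0, y 1) \<in> edges D" "(y 1, y 2) \<in> edges D" "(y 2, y 3) \<in> edges D"
        "(y 3, y 4) \<in> edges D"
        by (simp_all add: eval_nat_numeral)
      have out: "v = w" if "(u, v) \<in> edges D" "(u, w) \<in> edges D" for u v w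
        using that unfolding E by (auto simp: Suc_eq)
      have inn: "u = v" if "(u, w) \<in> edges D" "(v, w) \<in> edges D" for u v w
        using that unfolding E by (auto simp: Suc_eq)
      have "weight D (y 1) \<noteq> 1" and y2: "weight D (y 2) = 1"
        using j by (simp_all add: y_def)
      moreover have "1 \<le> weight D (y 1)"
        using weight_pos V by (simp add: y_def)
      ultimately have "2 \<le> weight D (y 1)"
        by linarith
      from symbolic_cube_ne_cube[OF assms(1) path dist out inn this y2]
      have "symbolic_power (mpoly_ring (verts D)) (edge_ideal D) 3
        \<noteq> ideal_power (mpoly_ring (verts D) :: (('v \<Rightarrow>\<^sub>0 nat) \<Rightarrow>\<^sub>0 'k) ring) (edge_ideal D) 3"
        .
      then show False
        using eq by simp
    qed
  qed
qed

end
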